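(* For any positive integer $n$, $$\sum_{k=0}^{\binom{n}{2}}i_{B'}(n,k)z^{k}=\begin{cases}1, & \text{if } n=1,\\ (1+2z)(1+2z+2z^2)\cdots(1+2z+\cdots+2z^{n-1}), & \text{if } n>1,\end{cases}$$ as an identity of polynomials in $z$; for $n>1$ the product is $\prod_{m=1}^{n-1}\bigl(1+2\sum_{j=1}^{m}z^j\bigr)$.
   Context: For $n\ge 1$, $B'_n$ denotes the set of overlined permutations of $\{1,\dots,n\}$ of the following kind: an element is a permutation $\sigma=\sigma_1\sigma_2\cdots\sigma_n$ of $\{1,\dots,n\}$ (in one-line notation) in which each entry $\sigma_i$ is independently either overlined or not overlined, subject to the condition that $\sigma_i$ may be overlined only if there is an index $j>i$ with $\sigma_i>\sigma_j$ (overlines are ignored in comparing entries). An inversion of such an element is a pair of positions $i<j$ with $\sigma_i>\sigma_j$, again ignoring overlines. The over-Mahonian number $i_{B'}(n,k)$ is the number of elements of $B'_n$ with exactly $k$ inversions. *)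

theory Defs
  imports "HOL-Combinatorics.Multiset_Permutations" "HOL-Computational_Algebra.Polynomial"
begin

text \<open>An overlined permutation of \<open>{1..n}\<close> in one-line notation is a list of pairs
  \<open>(\<sigma>\<^sub>i, b\<^sub>i)\<close>, where \<open>b\<^sub>i\<close> says whether the entry \<open>\<sigma>\<^sub>i\<close> is overlined. Positions are
  counted from 0, entries from 1.\<close>

definition overlined_perms_B' :: "nat \<Rightarrow> (nat \<times> bool) list set" where
  "overlined_perms_B' n =
     {w. map fst w \<in> permutations_of_set {1..n} \<and>
         (\<forall>i<length w. snd (w ! i) \<longrightarrow> (\<exists>j. i < j \<and> j < length w \<and> fst (w ! i) > fst (w ! j)))}"

definition inversions :: "(nat \<times> bool) list \<Rightarrow> (nat \<times> nat) set" where
  "inversions w = {(i, j). i < j \<and> j < length w \<and> fst (w ! i) > fst (w ! j)}"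

definition over_mahonian_B' :: "nat \<Rightarrow> nat \<Rightarrow> nat" where
  "over_mahonian_B' n k = card {w \<in> overlined_perms_B' n. card (inversions w) = k}"

lemma finite_overlined_perms_B': "finite (overlined_perms_B' n)"
proof (rule finite_subset)
  show "overlined_perms_B' n \<subseteq> {w. set w \<subseteq> {1..n} \<times> UNIV \<and> length w = n}"
  proof
    fix w assume "w \<in> overlined_perms_B' n"
    then have w: "set (map fst w) = {1..n}" "distinct (map fst w)"
      by (auto simp: overlined_perms_B'_def permutations_of_set_def)
    then have "length w = n"
      using distinct_card[of "map fst w"] by simp
    moreover have "set w \<subseteq> {1..n} \<times> UNIV"
      using w(1) by force
    ultimately show "w \<in> {w. set w \<subseteq> {1..n} \<times> UNIV \<and> length w = n}" by simp
  qed
  show "finite {w. set w \<subseteq> {1..n} \<times> (UNIV :: bool set) \<and> length w = n}"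
    by (rule finite_lists_length_eq) simp
qed

lemma finite_inversions: "finite (inversions w)"
  by (rule finite_subset[of _ "{..<length w} \<times> {..<length w}"]) (auto simp: inversions_def)

end

theory Submission
  imports Defs
begin

text \<open>The product formula comes from reading an overlined permutation from left to right. If the
  first entry has exactly \<open>r\<close> smaller entries in the underlying set, it is the larger member of
  exactly \<open>r\<close> inversions, whatever follows it, and it may carry an overline iff \<open>r > 0\<close>. The
  tail is an arbitrary overlined arrangement of the remaining entries. As the first entry varies
  over a set of size \<open>m + 1\<close>, the number \<open>r\<close> takes each of the values \<open>0, \<dots>, m\<close> once, so this
  choice contributes the factor \<open>1 + 2z + \<dots> + 2z\<^sup>m\<close>.

  Removing an entry from \<open>{1..n}\<close> does not leave an initial segment. Instead of renumbering the
  tail, the count is made over arrangements of an arbitrary finite set of naturals: its generating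
  function depends only on the cardinality (\<open>inversion_gf_eq_prod\<close>), which makes the
  recursion on the first entry (\<open>inversion_gf_rec\<close>) close up by induction.\<close>

definition overlined_arrangements :: "nat set \<Rightarrow> (nat \<times> bool) list set" where
  "overlined_arrangements A =
     {w. map fst w \<in> permutations_of_set A \<and>
         (\<forall>i<length w. snd (w ! i) \<longrightarrow> (\<exists>j. i < j \<and> j < length w \<and> fst (w ! i) > fst (w ! j)))}"

definition inversion_gf :: "nat set \<Rightarrow> int poly" where
  "inversion_gf A = (\<Sum>w\<in>overlined_arrangements A. monom 1 (card (inversions w)))"

definition rank_in :: "nat set \<Rightarrow> nat \<Rightarrow> nat" where
  "rank_in A x = card {y \<in> A. y < x}"

definition allowed_overlines :: "nat set \<Rightarrow> nat \<Rightarrow> bool set" where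
  "allowed_overlines A x = (if rank_in A x = 0 then {False} else UNIV)"

lemma overlined_perms_B'_eq: "overlined_perms_B' n = overlined_arrangements {1..n}"
  by (simp add: overlined_perms_B'_def overlined_arrangements_def)

lemma overlined_arrangements_empty: "overlined_arrangements {} = {[]}"
  by (auto simp: overlined_arrangements_def)

lemma inversions_Nil: "inversions [] = {}"
  by (auto simp: inversions_def)

text \<open>Inversions either use position 0 or are those of the tail, shifted by one position.\<close>

lemma card_inversions_Cons:
  "card (inversions (p # w)) = length (filter (\<lambda>y. y < fst p) (map fst w)) + card (inversions w)"
proof -
  let ?J = "{j. j < length w \<and> fst (w ! j) < fst p}"
  have split: "inversions (p # w) = (\<lambda>j. (0, Suc j)) ` ?J \<union> map_prod Suc Suc ` inversions w"
  proof (intro set_eqI, clarify)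
    fix i j
    show "(i, j) \<in> inversions (p # w) \<longleftrightarrow>
      (i, j) \<in> (\<lambda>j. (0, Suc j)) ` ?J \<union> map_prod Suc Suc ` inversions w"
      by (cases i; cases j) (auto simp: inversions_def image_iff)
  qed
  have "card (inversions (p # w)) =
      card ((\<lambda>j. (0 :: nat, Suc j)) ` ?J) + card (map_prod Suc Suc ` inversions w)"
    unfolding split by (rule card_Un_disjoint) (auto simp: finite_inversions)
  also have "card ((\<lambda>j. (0 :: nat, Suc j)) ` ?J) = card ?J"
    by (rule card_image) (auto simp: inj_on_def)
  also have "card (map_prod Suc Suc ` inversions w) = card (inversions w)"
    by (rule card_image) (auto simp: inj_on_def)
  also have "card ?J = length (filter (\<lambda>y. y < fst p) (map fst w))"
    unfolding length_filter_conv_card by (intro arg_cong[where f = card]) auto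
  finally show ?thesis .
qed

lemma card_inversions_le: "card (inversions w) \<le> length w choose 2"
proof (induction w)
  case Nil
  show ?case by (simp add: inversions_Nil)
next
  case (Cons p w)
  have "length (filter (\<lambda>y. y < fst p) (map fst w)) \<le> length w"
    using length_filter_le[of _ "map fst w"] by simp
  with Cons show ?case by (simp add: card_inversions_Cons numeral_2_eq_2 del: length_filter_map)
qed

lemma length_filter_less_permutation:
  assumes "x \<in> A" "xs \<in> permutations_of_set (A - {x})"
  shows "length (filter (\<lambda>y. y < x) xs) = rank_in A x"
proof -
  have "length (filter (\<lambda>y. y < x) xs) = card (set (filter (\<lambda>y. y < x) xs))"
    using assms(2) by (intro distinct_card[symmetric]) (auto simp: permutations_of_set_def)
  also have "set (filter (\<lambda>y. y < x) xs) = {y \<in> A. y < x}"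
    using assms by (auto simp: permutations_of_set_def)
  finally show ?thesis by (simp add: rank_in_def)
qed

text \<open>Whether an overline on the first entry is legal depends on the entry alone: all smaller
  entries come after it. The legality of later overlines is a condition on the tail.\<close>

lemma Cons_in_overlined_arrangements:
  assumes "finite A"
  shows "(x, b) # w \<in> overlined_arrangements A \<longleftrightarrow>
    x \<in> A \<and> b \<in> allowed_overlines A x \<and> w \<in> overlined_arrangements (A - {x})"
proof -
  let ?ok = "\<lambda>w. \<forall>i<length w. snd (w ! i) \<longrightarrow>
    (\<exists>j. i < j \<and> j < length w \<and> fst (w ! i) > fst (w ! j :: nat \<times> bool))"
  have perm: "map fst ((x, b) # w) \<in> permutations_of_set A \<longleftrightarrow>
    x \<in> A \<and> map fst w \<in> permutations_of_set (A - {x})"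
    by (auto simp: permutations_of_set_def)
  have ex_Suc: "(\<exists>j. Suc i < j \<and> j < Suc m \<and> P j) \<longleftrightarrow> (\<exists>j. i < j \<and> j < m \<and> P (Suc j))"
    for i m P
    by (metis Suc_less_eq Suc_less_eq2)
  have ex_0: "(\<exists>j. 0 < j \<and> j < Suc m \<and> P j) \<longleftrightarrow> (\<exists>j<m. P (Suc j))" for m P
    by (metis Suc_less_eq gr0_conv_Suc zero_less_Suc)
  have ok: "?ok ((x, b) # w) \<longleftrightarrow> (b \<longrightarrow> (\<exists>j<length w. fst (w ! j) < x)) \<and> ?ok w"
    by (simp add: All_less_Suc2 ex_Suc ex_0)
  have "(b \<longrightarrow> (\<exists>j<length w. fst (w ! j) < x)) \<longleftrightarrow> b \<in> allowed_overlines A x"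
    if "x \<in> A" "map fst w \<in> permutations_of_set (A - {x})"
  proof -
    have set: "fst ` set w = A - {x}"
      using that(2) by (simp add: permutations_of_set_def)
    have "(\<exists>j<length w. fst (w ! j) < x) \<longleftrightarrow> (\<exists>y\<in>fst ` set w. y < x)"
      using all_set_conv_all_nth[of w "\<lambda>y. \<not> fst y < x"] by auto
    also have "\<dots> \<longleftrightarrow> {y \<in> A. y < x} \<noteq> {}"
      unfolding set by auto
    also have "\<dots> \<longleftrightarrow> rank_in A x \<noteq> 0"
      using assms by (simp add: rank_in_def card_eq_0_iff)
    finally show ?thesis by (auto simp: allowed_overlines_def)
  qed
  with perm ok show ?thesis
    unfolding overlined_arrangements_def mem_Collect_eq by blast
qed

lemma finite_overlined_arrangements:
  assumes "finite A"
  shows "finite (overlined_arrangements A)"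
proof (rule finite_subset)
  show "overlined_arrangements A \<subseteq> {w. set w \<subseteq> A \<times> UNIV \<and> length w = card A}"
  proof
    fix w assume "w \<in> overlined_arrangements A"
    then have perm: "map fst w \<in> permutations_of_set A"
      by (simp add: overlined_arrangements_def)
    then have "fst ` set w = A" "length w = card A"
      using length_finite_permutations_of_set[OF perm] by (auto simp: permutations_of_set_def)
    then show "w \<in> {w. set w \<subseteq> A \<times> UNIV \<and> length w = card A}" by force
  qed
  show "finite {w. set w \<subseteq> A \<times> (UNIV :: bool set) \<and> length w = card A}"
    using assms by (intro finite_lists_length_eq) simp
qed

lemma bij_betw_rank_in:
  assumes "finite A"
  shows "bij_betw (rank_in A) A {..<card A}"
proof -
  have mono: "rank_in A x < rank_in A y" if "x \<in> A" "x < y" for x y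
    unfolding rank_in_def using that assms by (intro psubset_card_mono) auto
  have inj: "inj_on (rank_in A) A"
  proof (rule inj_onI)
    fix x y assume "x \<in> A" "y \<in> A" "rank_in A x = rank_in A y"
    then show "x = y" using mono[of x y] mono[of y x] by (cases x y rule: linorder_cases) auto
  qed
  have "rank_in A x < card A" if "x \<in> A" for x
    unfolding rank_in_def using that assms by (intro psubset_card_mono) auto
  then have "rank_in A ` A = {..<card A}"
    by (intro card_subset_eq) (auto simp: card_image inj)
  with inj show ?thesis by (simp add: bij_betw_def)
qed

text \<open>The coefficient 2 records the choice of overlining or not; it is missing at \<open>z\<^sup>0\<close> because
  the minimum of \<open>A\<close> cannot be overlined.\<close>

lemma sum_first_entry:
  assumes "finite A" "card A = Suc m"
  shows "(\<Sum>x\<in>A. \<Sum>b\<in>allowed_overlines A x. monom 1 (rank_in A x)) =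
    (1 + 2 * (\<Sum>j = 1..m. monom 1 j) :: int poly)"
proof -
  let ?c = "\<lambda>r. (if r = 0 then 1 else 2) * monom 1 r :: int poly"
  have "(\<Sum>x\<in>A. \<Sum>b\<in>allowed_overlines A x. monom 1 (rank_in A x)) = (\<Sum>x\<in>A. ?c (rank_in A x))"
    by (intro sum.cong) (auto simp: allowed_overlines_def UNIV_bool)
  also have "\<dots> = (\<Sum>r<Suc m. ?c r)"
    using sum.reindex_bij_betw[OF bij_betw_rank_in[OF assms(1)], of ?c] assms(2) by simp
  also have "\<dots> = ?c 0 + (\<Sum>r = 1..m. ?c r)"
    by (simp add: lessThan_Suc_atMost atMost_atLeast0 sum.atLeast_Suc_atMost)
  also have "(\<Sum>r = 1..m. ?c r) = 2 * (\<Sum>r = 1..m. monom 1 r)"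
    unfolding sum_distrib_left by (intro sum.cong) auto
  finally show ?thesis by (simp add: monom_0)
qed

lemma inversion_gf_rec:
  assumes "finite A" "A \<noteq> {}"
  shows "inversion_gf A =
    (\<Sum>x\<in>A. \<Sum>b\<in>allowed_overlines A x. monom 1 (rank_in A x) * inversion_gf (A - {x}))"
proof -
  let ?S = "SIGMA x:A. SIGMA b:allowed_overlines A x. overlined_arrangements (A - {x})"
  let ?cons = "\<lambda>(x, b, w). (x, b) # w"
  have "overlined_arrangements A = ?cons ` ?S"
  proof (intro set_eqI)
    fix v
    have "v \<noteq> []" if "v \<in> overlined_arrangements A"
      using that assms(2) by (auto simp: overlined_arrangements_def permutations_of_set_def)
    then show "v \<in> overlined_arrangements A \<longleftrightarrow> v \<in> ?cons ` ?S"
      by (cases v) (auto simp: Cons_in_overlined_arrangements[OF assms(1)] image_iff)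
  qed
  moreover have "inj_on ?cons ?S"
    by (auto simp: inj_on_def)
  ultimately have bij: "bij_betw ?cons ?S (overlined_arrangements A)"
    by (simp add: bij_betw_def)
  have "inversion_gf A = (\<Sum>t\<in>?S. monom 1 (card (inversions (?cons t))))"
    unfolding inversion_gf_def by (rule sum.reindex_bij_betw[OF bij, symmetric])
  also have "\<dots> = (\<Sum>x\<in>A. \<Sum>b\<in>allowed_overlines A x. \<Sum>w\<in>overlined_arrangements (A - {x}).
      monom 1 (card (inversions ((x, b) # w))))"
    using assms(1) by (simp add: sum.Sigma finite_overlined_arrangements split_beta)
  also have "\<dots> = (\<Sum>x\<in>A. \<Sum>b\<in>allowed_overlines A x. \<Sum>w\<in>overlined_arrangements (A - {x}).
      monom 1 (rank_in A x) * monom 1 (card (inversions w)))"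
    by (intro sum.cong refl)
       (simp add: card_inversions_Cons length_filter_less_permutation
         overlined_arrangements_def mult_monom del: length_filter_map)
  finally show ?thesis by (simp add: inversion_gf_def sum_distrib_left)
qed

lemma inversion_gf_eq_prod:
  assumes "finite A"
  shows "inversion_gf A = (\<Prod>m<card A. 1 + 2 * (\<Sum>j = 1..m. monom 1 j))"
  using assms
proof (induction "card A" arbitrary: A)
  case 0
  then show ?case
    by (simp add: inversion_gf_def overlined_arrangements_empty inversions_Nil monom_0)
next
  case (Suc n)
  let ?P = "\<Prod>m<n. 1 + 2 * (\<Sum>j = 1..m. monom 1 j) :: int poly"
  have IH: "inversion_gf (A - {x}) = ?P" if "x \<in> A" for x
  proof -
    have "n = card (A - {x})" using that Suc.hyps(2) Suc.prems by simp
    with Suc.hyps(1)[of "A - {x}"] Suc.prems show ?thesis by simp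
  qed
  have "A \<noteq> {}" using Suc.hyps(2) by auto
  then have "inversion_gf A =
      (\<Sum>x\<in>A. \<Sum>b\<in>allowed_overlines A x. monom 1 (rank_in A x) * ?P)"
    by (simp add: inversion_gf_rec[OF Suc.prems] IH)
  also have "\<dots> = (\<Sum>x\<in>A. \<Sum>b\<in>allowed_overlines A x. monom 1 (rank_in A x)) * ?P"
    by (simp only: sum_distrib_right)
  also have "\<dots> = (1 + 2 * (\<Sum>j = 1..n. monom 1 j)) * ?P"
    by (simp only: sum_first_entry[OF Suc.prems Suc.hyps(2)[symmetric]])
  finally show ?case
    unfolding Suc.hyps(2)[symmetric] by (simp add: mult.commute)
qed

text \<open>The truncation of the sum at \<open>n choose 2\<close> loses nothing, by \<open>card_inversions_le\<close>.\<close>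

lemma sum_over_mahonian_B'_eq_gf:
  "(\<Sum>k = 0..n choose 2. monom (int (over_mahonian_B' n k)) k) = inversion_gf {1..n}"
proof -
  let ?W = "overlined_perms_B' n"
  have len: "length w = n" if "w \<in> ?W" for w
    using that length_finite_permutations_of_set[of "map fst w" "{1..n}"]
    by (simp add: overlined_perms_B'_def)
  have "inversion_gf {1..n} = (\<Sum>w\<in>?W. monom 1 (card (inversions w)))"
    by (simp add: inversion_gf_def overlined_perms_B'_eq)
  also have "\<dots> = (\<Sum>k = 0..n choose 2. \<Sum>w | w \<in> ?W \<and> card (inversions w) = k.
      monom 1 (card (inversions w)))"
    using card_inversions_le len
    by (intro sum.group[symmetric]) (fastforce simp: finite_overlined_perms_B')+
  also have "\<dots> = (\<Sum>k = 0..n choose 2. monom (int (over_mahonian_B' n k)) k)"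
    by (intro sum.cong refl) (simp add: over_mahonian_B'_def of_nat_monom mult_monom)
  finally show ?thesis ..
qed

theorem theorem2p10:
  fixes n :: nat
  assumes "n \<ge> 1"
  shows "(\<Sum>k = 0..n choose 2. monom (int (over_mahonian_B' n k)) k) =
    (if n = 1 then 1
     else (\<Prod>m = 1..n - 1. 1 + 2 * (\<Sum>j = 1..m. monom 1 j)))"
proof -
  obtain m where n: "n = Suc m" using assms by (cases n) auto
  \<comment> \<open>The factor with index 0 is 1; it belongs to the last entry, which is never overlined.\<close>
  have "(\<Prod>i<n. 1 + 2 * (\<Sum>j = 1..i. monom 1 j)) =
      (\<Prod>i = 1..m. 1 + 2 * (\<Sum>j = 1..i. monom 1 j) :: int poly)"
    by (simp add: n lessThan_Suc_atMost atMost_atLeast0 prod.atLeast_Suc_atMost)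
  then show ?thesis
    by (simp add: sum_over_mahonian_B'_eq_gf inversion_gf_eq_prod n)
qed

end
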